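(* Let $M$ be a signed permutation matrix. The following are equivalent: (a) there exists an eigenvector of $M$ with eigenvalue $1$ all of whose entries are non-zero; (b) every cycle in the cycle decomposition of $\sigma_M$ contains an even number of $-1$'s (with respect to $M$).
   Context: A $k\times k$ matrix with entries in $\{0,1,-1\}$ is a signed permutation matrix if it has exactly one non-zero entry in each row and each column. For such $M$, $\sigma_M$ is the permutation of $\{1,\dots,k\}$ such that the $(i,\sigma_M(i))$ entry of $M$ is non-zero. If $(i_1\,\ldots\,i_r)$ is a cycle in the cycle decomposition of $\sigma_M$ (fixed points counted as cycles of length 1), the number of $-1$'s in this cycle (with respect to $M$) is the number of $j\in\{1,\dots,r\}$ such that row $i_j$ of $M$ contains an entry $-1$. *)

theory Defs
  imports "Jordan_Normal_Form.Char_Poly" "HOL-Combinatorics.Cycles"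
begin

text \<open>Rows and columns are indexed by \<open>{..<k}\<close>, as usual for \<^typ>\<open>'a mat\<close>, instead of
  \<open>{1..k}\<close>. Over a field of characteristic 0 the entries 0, 1 and -1 are distinct.\<close>

definition signed_perm_mat :: "nat \<Rightarrow> 'a :: field_char_0 mat \<Rightarrow> bool" where
  "signed_perm_mat k M \<longleftrightarrow>
     M \<in> carrier_mat k k \<and>
     (\<forall>i<k. \<forall>j<k. M $$ (i, j) \<in> {0, 1, -1}) \<and>
     (\<forall>i<k. \<exists>!j. j < k \<and> M $$ (i, j) \<noteq> 0) \<and>
     (\<forall>j<k. \<exists>!i. i < k \<and> M $$ (i, j) \<noteq> 0)"

text \<open>Extended by the identity outside the index set, so that it satisfies \<^const>\<open>permutes\<close>.\<close>

definition sigma :: "'a :: field_char_0 mat \<Rightarrow> nat \<Rightarrow> nat" where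
  "sigma M i = (if i < dim_row M then (THE j. j < dim_col M \<and> M $$ (i, j) \<noteq> 0) else i)"

lemma signed_perm_matD:
  assumes "signed_perm_mat k M"
  shows "dim_row M = k" "dim_col M = k"
    and "i < k \<Longrightarrow> \<exists>!j. j < k \<and> M $$ (i, j) \<noteq> 0"
    and "j < k \<Longrightarrow> \<exists>!i. i < k \<and> M $$ (i, j) \<noteq> 0"
  using assms unfolding signed_perm_mat_def carrier_mat_def by simp_all

lemma sigma_nonzero:
  assumes "signed_perm_mat k M" "i < k"
  shows "sigma M i < k" "M $$ (i, sigma M i) \<noteq> 0"
proof -
  have "sigma M i = (THE j. j < k \<and> M $$ (i, j) \<noteq> 0)"
    using assms(2) by (simp add: sigma_def signed_perm_matD(1,2)[OF assms(1)])
  then show "sigma M i < k" "M $$ (i, sigma M i) \<noteq> 0"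
    using theI'[OF signed_perm_matD(3)[OF assms]] by simp_all
qed

lemma sigma_permutes:
  assumes "signed_perm_mat k M"
  shows "sigma M permutes {..<k}"
proof -
  have inj: "inj_on (sigma M) {..<k}"
  proof (rule inj_onI)
    fix i i' assume "i \<in> {..<k}" "i' \<in> {..<k}" and eq: "sigma M i = sigma M i'"
    then have i: "i < k" "i' < k" by simp_all
    have "M $$ (i, sigma M i) \<noteq> 0" "M $$ (i', sigma M i) \<noteq> 0"
      using sigma_nonzero(2)[OF assms i(1)] sigma_nonzero(2)[OF assms i(2)] eq by simp_all
    then show "i = i'"
      using signed_perm_matD(4)[OF assms sigma_nonzero(1)[OF assms i(1)]] i by (metis (no_types))
  qed
  have "sigma M ` {..<k} \<subseteq> {..<k}"
    using sigma_nonzero(1)[OF assms] by (simp add: image_subset_iff)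
  then have "bij_betw (sigma M) {..<k} {..<k}"
    using inj by (simp add: bij_betw_def endo_inj_surj)
  moreover have "sigma M i = i" if "i \<notin> {..<k}" for i
    using that by (simp add: sigma_def signed_perm_matD(1)[OF assms])
  ultimately show ?thesis by (rule bij_imp_permutes)
qed

text \<open>\<^term>\<open>support p i\<close> is the list \<open>[i, p i, p (p i), \<dots>]\<close> running once through the cycle
  of \<open>i\<close>; it is \<open>[i]\<close> for a fixed point. Each cycle of length \<open>r\<close> is listed \<open>r\<close> times, once
  for each choice of its first element.\<close>

definition cycles_on :: "nat \<Rightarrow> (nat \<Rightarrow> nat) \<Rightarrow> nat list set" where
  "cycles_on k p = {support p i | i. i < k}"

definition num_minus_ones :: "'a :: field_char_0 mat \<Rightarrow> nat list \<Rightarrow> nat" where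
  "num_minus_ones M c = card {j. j < length c \<and> (\<exists>l < dim_col M. M $$ (c ! j, l) = -1)}"

end

theory Submission
  imports Defs
begin

text \<open>Write \<open>p\<close> for the permutation of \<open>M\<close> and \<open>s i\<close> for the non-zero entry of row \<open>i\<close>. Then
  \<open>M v = v\<close> says \<open>v i = s i * v (p i)\<close> for all \<open>i\<close>, so going once around the cycle of \<open>i\<close> gives
  \<open>v i = c * v i\<close>, where \<open>c\<close> is the product of the entries along the cycle, i.e. \<open>-1\<close> to the
  number of its \<open>-1\<close>'s. If \<open>v i \<noteq> 0\<close> then \<open>c = 1\<close>. Conversely, if all these products are \<open>1\<close>,
  then the product of the entries met on the way from \<open>i\<close> to a fixed representative of its cycle
  does not depend on the number of turns taken, and it is a solution \<open>v i\<close>.\<close>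

text \<open>The end point \<open>(p ^^ n) x\<close> contributes no factor, so consecutive paths
  concatenate without overlap.\<close>

definition path_prod :: "('b \<Rightarrow> 'a :: comm_monoid_mult) \<Rightarrow> ('b \<Rightarrow> 'b) \<Rightarrow> nat \<Rightarrow> 'b \<Rightarrow> 'a" where
  "path_prod s p n x = (\<Prod>j<n. s ((p ^^ j) x))"

lemma path_prod_0 [simp]: "path_prod s p 0 x = 1"
  by (simp add: path_prod_def)

lemma path_prod_Suc: "path_prod s p (Suc n) x = s x * path_prod s p n (p x)"
  by (simp add: path_prod_def prod.lessThan_Suc_shift funpow_swap1 del: prod.lessThan_Suc)

lemma path_prod_add:
  "path_prod s p (m + n) x = path_prod s p m x * path_prod s p n ((p ^^ m) x)"
  by (induction m arbitrary: x) (simp_all add: path_prod_Suc funpow_swap1 mult.assoc)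

text \<open>The least period divides \<open>n\<close>, so the closed path consists of whole turns,
  each contributing 1.\<close>

lemma path_prod_eq_1_if_period:
  assumes "(p ^^ n) x = x" and "path_prod s p (least_power p x) x = 1"
  shows "path_prod s p n x = 1"
proof (cases "n = 0")
  case False
  have period: "(p ^^ least_power p x) x = x"
    using least_powerI(1)[OF assms(1)] False by simp
  have "path_prod s p (q * least_power p x) x = 1" for q
    by (induction q) (simp_all add: path_prod_add period assms(2))
  moreover have "least_power p x dvd n"
    using assms(1) by (rule least_power_minimal)
  ultimately show ?thesis
    by (auto simp: mult.commute elim!: dvdE)
qed simp

text \<open>The longer path is the shorter one followed by a closed path at \<open>y\<close>, whose
  product is 1.\<close>

lemma path_prod_eq_if_same_end:
  assumes "(p ^^ m) x = y" and "(p ^^ n) x = y"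
    and "path_prod s p (least_power p y) y = 1"
  shows "path_prod s p m x = path_prod s p n x"
proof -
  have le: "path_prod s p a x = path_prod s p b x"
    if ab: "a \<le> b" "(p ^^ a) x = y" "(p ^^ b) x = y" for a b
  proof -
    obtain d where b: "b = a + d"
      using le_Suc_ex[OF ab(1)] by blast
    have "(p ^^ d) y = y"
      using ab(2,3) funpow_add[of d a p] by (simp add: b add.commute)
    from path_prod_eq_1_if_period[OF this assms(3)] show ?thesis
      by (simp add: b path_prod_add ab(2))
  qed
  show ?thesis
    using nat_le_linear[of m n] le[OF _ assms(1,2)] le[OF _ assms(2,1), symmetric] by blast
qed

lemma funpow_in_if_permutes:
  assumes "p permutes A" and "x \<in> A"
  shows "(p ^^ n) x \<in> A"
  using assms by (induction n) (simp_all add: permutes_in_image)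

text \<open>The equivalence for arbitrary non-zero weights: signs and matrices enter only when
  \<open>s\<close> and \<open>p\<close> are specialised.\<close>

lemma ex_nonzero_twisted_invariant_iff:
  fixes s :: "'b \<Rightarrow> 'a :: field"
  assumes "finite A" and p: "p permutes A" and nz: "\<And>x. x \<in> A \<Longrightarrow> s x \<noteq> 0"
  shows "(\<exists>f. \<forall>x\<in>A. f x \<noteq> 0 \<and> f x = s x * f (p x)) \<longleftrightarrow>
         (\<forall>x\<in>A. path_prod s p (least_power p x) x = 1)"
proof
  have perm: "permutation p"
    using assms by (auto simp: permutation_permutes)
  {
    assume "\<exists>f. \<forall>x\<in>A. f x \<noteq> 0 \<and> f x = s x * f (p x)"
    then obtain f where f: "\<And>x. x \<in> A \<Longrightarrow> f x \<noteq> 0" "\<And>x. x \<in> A \<Longrightarrow> f x = s x * f (p x)"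
      by blast
    \<comment> \<open>Iterate the equation; after a full turn both ends are \<open>f x\<close>,
      which cancels because it is non-zero.\<close>
    have path: "f x = path_prod s p n x * f ((p ^^ n) x)" if "x \<in> A" for n x
      using that
    proof (induction n arbitrary: x)
      case (Suc n)
      then have "f (p x) = path_prod s p n (p x) * f ((p ^^ n) (p x))"
        using p by (simp add: permutes_in_image)
      then show ?case
        using f(2)[OF Suc.prems] by (simp add: path_prod_Suc funpow_swap1 mult.assoc)
    qed simp
    show "\<forall>x\<in>A. path_prod s p (least_power p x) x = 1"
    proof
      fix x assume "x \<in> A"
      then show "path_prod s p (least_power p x) x = 1"
        using path[of x "least_power p x"] f(1)[of x]
        by (simp add: least_power_of_permutation(1)[OF perm])
    qed
  }
  assume one: "\<forall>x\<in>A. path_prod s p (least_power p x) x = 1"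
  \<comment> \<open>The choice depends only on the set of points of the cycle, so all of them get
    the same representative. \<open>len\<close> is any number of steps reaching it, not necessarily
    the least.\<close>
  define rep where "rep x = (SOME y. y \<in> set (support p x))" for x
  define len where "len x = (SOME n. (p ^^ n) x = rep x)" for x
  define f where "f x = path_prod s p (len x) x" for x
  have len: "(p ^^ len x) x = rep x" for x
  proof -
    have "set (support p x) \<noteq> {}"
      by (simp add: support_set[OF perm] del: set_map)
    then have "rep x \<in> set (support p x)"
      unfolding rep_def by (simp add: some_in_eq)
    then have "\<exists>n. (p ^^ n) x = rep x"
      unfolding support_set[OF perm] by auto
    then show ?thesis
      unfolding len_def by (rule someI_ex)
  qed
  have rep_step: "rep (p x) = rep x" for x
  proof -
    have "x \<in> set (support p x)" "p x \<in> set (support p (p x))" "p x \<in> set (support p x)"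
      unfolding support_set[OF perm]
      using rangeI[of "\<lambda>i. (p ^^ i) x" 0] rangeI[of "\<lambda>i. (p ^^ i) x" 1]
        rangeI[of "\<lambda>i. (p ^^ i) (p x)" 0] by simp_all
    \<comment> \<open>Supports are equal or disjoint as sets, and these two share
      \<open>p x\<close>.\<close>
    then have "set (support p (p x)) = set (support p x)"
      using disjointD[OF disjoint_support[OF perm] rangeI rangeI, of "p x" x] by blast
    then show ?thesis
      by (simp only: rep_def)
  qed
  show "\<exists>f. \<forall>x\<in>A. f x \<noteq> 0 \<and> f x = s x * f (p x)"
  proof (intro exI ballI conjI)
    fix x assume x: "x \<in> A"
    show "f x \<noteq> 0"
      using funpow_in_if_permutes[OF p x] nz by (simp add: f_def path_prod_def)
    \<comment> \<open>The path through \<open>p x\<close> may differ from the chosen one by some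
      turns, but both end at \<open>rep x\<close>, so their products agree.\<close>
    have "(p ^^ Suc (len (p x))) x = rep x"
      using len[of "p x"] rep_step by (simp add: funpow_swap1)
    moreover have "rep x \<in> A"
      using funpow_in_if_permutes[OF p x, of "len x"] len[of x] by simp
    ultimately have "path_prod s p (len x) x = path_prod s p (Suc (len (p x))) x"
      using path_prod_eq_if_same_end[OF len] one by blast
    then show "f x = s x * f (p x)"
      by (simp add: f_def path_prod_Suc)
  qed
qed

context
  fixes M :: "'a :: field_char_0 mat" and k :: nat
  assumes M: "signed_perm_mat k M"
begin

lemma signed_perm_mat_entry_eq_0:
  assumes "i < k" and "j < k" and "j \<noteq> sigma M i"
  shows "M $$ (i, j) = 0"
proof (rule ccontr)
  assume "M $$ (i, j) \<noteq> 0"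
  with signed_perm_matD(3)[OF M assms(1)] sigma_nonzero[OF M assms(1)] assms(2) have "j = sigma M i"
    by (auto elim!: ex1E)
  with assms(3) show False ..
qed

lemma signed_perm_mat_entry_sigma:
  assumes "i < k"
  shows "M $$ (i, sigma M i) \<in> {1, -1}"
proof -
  have "M $$ (i, sigma M i) \<in> {0, 1, -1}"
    using M sigma_nonzero(1)[OF M assms] assms by (simp only: signed_perm_mat_def)
  with sigma_nonzero(2)[OF M assms] show ?thesis
    by simp
qed

lemma signed_perm_mat_mult_vec:
  assumes "i < k" and "v \<in> carrier_vec k"
  shows "(M *\<^sub>v v) $ i = M $$ (i, sigma M i) * v $ sigma M i"
proof -
  have "(M *\<^sub>v v) $ i = (\<Sum>j<k. M $$ (i, j) * v $ j)"
    using assms signed_perm_matD(1,2)[OF M]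
    by (auto simp: scalar_prod_def atLeast0LessThan intro!: sum.cong)
  also have "\<dots> = (\<Sum>j\<in>{sigma M i}. M $$ (i, j) * v $ j)"
    using sigma_nonzero(1)[OF M] signed_perm_mat_entry_eq_0 assms(1)
    by (intro sum.mono_neutral_right) auto
  finally show ?thesis
    by simp
qed

lemma ex_eigenvector_iff:
  assumes "k \<ge> 1"
  shows "(\<exists>v. eigenvector M v 1 \<and> (\<forall>i<k. v $ i \<noteq> 0)) \<longleftrightarrow>
         (\<exists>f. \<forall>i\<in>{..<k}. f i \<noteq> 0 \<and> f i = M $$ (i, sigma M i) * f (sigma M i))"
proof
  note dims = signed_perm_matD(1,2)[OF M]
  {
    assume "\<exists>v. eigenvector M v 1 \<and> (\<forall>i<k. v $ i \<noteq> 0)"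
    then obtain v where v: "v \<in> carrier_vec k" "M *\<^sub>v v = v" "\<forall>i<k. v $ i \<noteq> 0"
      by (auto simp: eigenvector_def dims)
    then have "\<forall>i\<in>{..<k}. v $ i \<noteq> 0 \<and> v $ i = M $$ (i, sigma M i) * v $ sigma M i"
      using signed_perm_mat_mult_vec[OF _ v(1)] unfolding v(2) by simp
    then show "\<exists>f. \<forall>i\<in>{..<k}. f i \<noteq> 0 \<and> f i = M $$ (i, sigma M i) * f (sigma M i)"
      by (rule exI[where x = "($) v"])
  }
  assume "\<exists>f. \<forall>i\<in>{..<k}. f i \<noteq> 0 \<and> f i = M $$ (i, sigma M i) * f (sigma M i)"
  then obtain f where f: "\<And>i. i < k \<Longrightarrow> f i \<noteq> 0"
      "\<And>i. i < k \<Longrightarrow> f i = M $$ (i, sigma M i) * f (sigma M i)"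
    by blast
  define v where "v = vec k f"
  have "M *\<^sub>v v = v"
  proof (rule eq_vecI)
    fix i assume "i < dim_vec v"
    then have i: "i < k"
      by (simp add: v_def)
    then show "(M *\<^sub>v v) $ i = v $ i"
      using signed_perm_mat_mult_vec[OF i, of v] f(2)[OF i] sigma_nonzero(1)[OF M i]
      by (simp add: v_def)
  qed (simp add: v_def dims)
  \<comment> \<open>Index 0 exists since \<open>k\<close> is positive; for \<open>k = 0\<close> the
    only vector is zero, hence no eigenvector.\<close>
  moreover have "v \<noteq> 0\<^sub>v k"
  proof
    assume "v = 0\<^sub>v k"
    then have "v $ 0 = 0"
      using assms by simp
    then show False
      using assms f(1) by (simp add: v_def)
  qed
  ultimately have "eigenvector M v 1"
    by (simp add: eigenvector_def v_def dims)
  then show "\<exists>v. eigenvector M v 1 \<and> (\<forall>i<k. v $ i \<noteq> 0)"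
    using f(1) by (intro exI[of _ v]) (simp add: v_def)
qed

text \<open>As -1 is non-zero, it can only be the single non-zero entry of its row. This links the
  row-wise count in \<open>num_minus_ones\<close> to the weights.\<close>

lemma minus_one_in_row_iff:
  assumes "i < k"
  shows "(\<exists>l<dim_col M. M $$ (i, l) = -1) \<longleftrightarrow> M $$ (i, sigma M i) = -1"
proof
  assume "\<exists>l<dim_col M. M $$ (i, l) = -1"
  then obtain l where l: "l < k" "M $$ (i, l) = -1"
    using signed_perm_matD(2)[OF M] by auto
  then have "l = sigma M i"
    using signed_perm_mat_entry_eq_0[OF assms, of l] by fastforce
  with l show "M $$ (i, sigma M i) = -1"
    by simp
next
  assume "M $$ (i, sigma M i) = -1"
  then show "\<exists>l<dim_col M. M $$ (i, l) = -1"
    using sigma_nonzero(1)[OF M assms] signed_perm_matD(2)[OF M] by auto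
qed

lemma path_prod_support_eq:
  assumes "i < k"
  shows "path_prod (\<lambda>i. M $$ (i, sigma M i)) (sigma M) (least_power (sigma M) i) i =
         (-1) ^ num_minus_ones M (support (sigma M) i)"
proof -
  let ?p = "sigma M" and ?s = "\<lambda>i. M $$ (i, sigma M i)"
  let ?n = "least_power ?p i"
  have in_k: "(?p ^^ j) i < k" for j
    using funpow_in_if_permutes[OF sigma_permutes[OF M], of i] assms by simp
  have eq: "{j. j < length (support ?p i) \<and> (\<exists>l<dim_col M. M $$ (support ?p i ! j, l) = -1)}
      = {j \<in> {..<?n}. ?s ((?p ^^ j) i) = -1}" (is "_ = ?R")
    by (simp add: minus_one_in_row_iff[OF in_k] cong: conj_cong)
  \<comment> \<open>Each weight is 1 or -1; the factors 1 drop out, leaving one -1 for each counted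
    position.\<close>
  have "path_prod ?s ?p ?n i = (\<Prod>j<?n. if ?s ((?p ^^ j) i) = -1 then -1 else 1)"
    unfolding path_prod_def using signed_perm_mat_entry_sigma[OF in_k]
    by (intro prod.cong) auto
  also have "\<dots> = (\<Prod>j\<in>?R. -1)"
    by (rule prod.inter_filter[symmetric]) simp
  also have "\<dots> = (-1) ^ card ?R"
    by simp
  finally show ?thesis
    unfolding num_minus_ones_def eq .
qed

end

theorem theorem5p4:
  fixes M :: "'a :: field_char_0 mat" and k :: nat
  assumes "k \<ge> 1" and "signed_perm_mat k M"
  shows "(\<exists>v. eigenvector M v 1 \<and> (\<forall>i<k. v $ i \<noteq> 0)) \<longleftrightarrow>
         (\<forall>c \<in> cycles_on k (sigma M). even (num_minus_ones M c))"
proof -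
  let ?s = "\<lambda>i. M $$ (i, sigma M i)"
  have "(\<exists>v. eigenvector M v 1 \<and> (\<forall>i<k. v $ i \<noteq> 0)) \<longleftrightarrow>
      (\<forall>i\<in>{..<k}. path_prod ?s (sigma M) (least_power (sigma M) i) i = 1)"
    unfolding ex_eigenvector_iff[OF assms(2,1)]
    using sigma_nonzero(2)[OF assms(2)]
    by (intro ex_nonzero_twisted_invariant_iff sigma_permutes assms(2)) auto
  also have "\<dots> \<longleftrightarrow> (\<forall>i<k. even (num_minus_ones M (support (sigma M) i)))"
  proof -
    \<comment> \<open>Characteristic 0 keeps -1 apart from 1, so the sign determines the
      parity.\<close>
    have "(-1 :: 'a) ^ n = 1 \<longleftrightarrow> even n" for n
      by (simp add: minus_one_power_iff)
    then show ?thesis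
      using path_prod_support_eq[OF assms(2)] by (simp add: Ball_def)
  qed
  also have "\<dots> \<longleftrightarrow> (\<forall>c\<in>cycles_on k (sigma M). even (num_minus_ones M c))"
    by (auto simp: cycles_on_def)
  finally show ?thesis .
qed

end
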